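(* Let $\theta=\frac{1+i\sqrt7}{2}$ and $\Gamma=\langle A,B\rangle\subset\mathrm{PSL}_2(\mathbb{Z}[\theta])$ with $A=\begin{pmatrix}1&1\\0&1\end{pmatrix}$, $B=\begin{pmatrix}1&0\\ \theta&1\end{pmatrix}$. If $X,Y\in\Gamma$ satisfy $\Gamma=\langle X,Y\rangle$ and $\mathrm{tr}\,X=\mathrm{tr}\,Y$, then $X$ and $Y$ are parabolic.
   Context: $\Gamma$ is the image of the discrete faithful representation of the fundamental group of the complement of the two-bridge link $6^2_3$ in $S^3$; it is a finite-covolume Kleinian group with traces in $\mathbb{Z}[\theta]$, the ring of integers of its trace field $\mathbb{Q}(\theta)$. Traces are taken of lifts to $\mathrm{SL}_2\mathbb{C}$; "$\mathrm{tr}\,X=\mathrm{tr}\,Y$" means the elements admit lifts of equal trace. Parabolic means non-identity with $\mathrm{tr}^2=4$. *)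

theory Defs
  imports "HOL-Analysis.Analysis"
begin

text \<open>Elements of PSL(2,C) are represented by their lifts to SL(2,C): 2x2 complex matrices.
  A subgroup of PSL(2,C) is represented by its full preimage in SL(2,C), i.e. a subgroup
  containing -I.\<close>

type_synonym cmat2 = "complex^2^2"

definition mat2 :: "complex \<Rightarrow> complex \<Rightarrow> complex \<Rightarrow> complex \<Rightarrow> cmat2" where
  "mat2 a b c d = (\<chi> i j. if i = 1 then (if j = 1 then a else b) else (if j = 1 then c else d))"

definition theta :: complex where
  "theta = (1 + \<i> * complex_of_real (sqrt 7)) / 2"

definition matA :: cmat2 where "matA = mat2 1 1 0 1"
definition matB :: cmat2 where "matB = mat2 1 0 theta 1"

inductive_set gen_grp :: "cmat2 set \<Rightarrow> cmat2 set" for S :: "cmat2 set" where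
  gen_one: "mat 1 \<in> gen_grp S"
| gen_base: "s \<in> S \<Longrightarrow> s \<in> gen_grp S"
| gen_mult: "x \<in> gen_grp S \<Longrightarrow> y \<in> gen_grp S \<Longrightarrow> x ** y \<in> gen_grp S"
| gen_inv: "x \<in> gen_grp S \<Longrightarrow> matrix_inv x \<in> gen_grp S"

text \<open>Preimage in SL(2,C) of the subgroup of PSL(2,C) generated by the images of the
  elements of S.\<close>
definition psl_gen :: "cmat2 set \<Rightarrow> cmat2 set" where
  "psl_gen S = gen_grp (insert (- mat 1) S)"

definition Gamma :: "cmat2 set" where
  "Gamma = psl_gen {matA, matB}"

definition parabolic :: "cmat2 \<Rightarrow> bool" where
  "parabolic M \<longleftrightarrow> M \<noteq> mat 1 \<and> M \<noteq> - mat 1 \<and> (trace M)\<^sup>2 = 4"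

end

theory Submission
  imports Defs
begin

text \<open>
  Write \<open>R = \<int>[\<theta>]\<close>, \<open>x = tr X = tr Y\<close>, \<open>z = tr XY\<close>. The \<open>R\<close>-span of \<open>1, X, Y, XY\<close> is an
  order containing \<open>\<Gamma>\<close>, hence \<open>A\<close> and \<open>B\<close>. The commutator \<open>UV - VU\<close> of two elements of this
  order is \<open>(XY - YX) M\<close> with \<open>M\<close> in the order, so \<open>det (XY - YX)\<close> divides
  \<open>det (AB - BA) = -\<theta>\<^sup>2\<close> in \<open>R\<close>. Conversely \<open>\<theta>\<^sup>2\<close> divides \<open>det (XY - YX)\<close>, because \<open>\<Gamma>\<close>
  consists of matrices that are upper triangular modulo \<open>\<theta>\<close> with diagonal entries \<open>1\<close>. The
  units of \<open>R\<close> are \<open>\<plusminus>1\<close>, and \<open>det (XY - YX) = -(z - 2) (z + 2 - x\<^sup>2)\<close>, so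
  \<open>(z - 2) (z + 2 - x\<^sup>2) = \<plusminus>\<theta>\<^sup>2\<close>. As \<open>\<theta>\<close> is a prime of norm \<open>2\<close> this leaves finitely
  many values for \<open>x\<^sup>2\<close>, and \<open>4\<close> is the only one that is a square in \<open>R\<close>.
\<close>

section \<open>Two-by-two matrices by entries\<close>

lemma mat2_nth [simp]:
  "mat2 a b c d $ 1 $ 1 = a" "mat2 a b c d $ 1 $ 2 = b"
  "mat2 a b c d $ 2 $ 1 = c" "mat2 a b c d $ 2 $ 2 = d"
  by (simp_all add: mat2_def)

lemma mat2_eta: "M = mat2 (M $ 1 $ 1) (M $ 1 $ 2) (M $ 2 $ 1) (M $ 2 $ 2)"
  by (simp add: vec_eq_iff forall_2)

lemma mat2_cases:
  obtains a b c d where "M = mat2 a b c d"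
  using mat2_eta by blast

lemma mat2_eq_iff [simp]:
  "mat2 a b c d = mat2 a' b' c' d' \<longleftrightarrow> a = a' \<and> b = b' \<and> c = c' \<and> d = d'"
  by (auto simp: vec_eq_iff forall_2)

lemma mat2_mult [simp]:
  "mat2 a b c d ** mat2 a' b' c' d' =
    mat2 (a * a' + b * c') (a * b' + b * d') (c * a' + d * c') (c * b' + d * d')"
  by (simp add: vec_eq_iff forall_2 matrix_matrix_mult_def sum_2)

lemma mat_eq_mat2: "(mat a :: cmat2) = mat2 a 0 0 a"
  by (simp add: vec_eq_iff forall_2 mat_def)

lemma uminus_mat2 [simp]: "- mat2 a b c d = mat2 (-a) (-b) (-c) (-d)"
  by (simp add: vec_eq_iff forall_2)

lemma add_mat2 [simp]: "mat2 a b c d + mat2 a' b' c' d' = mat2 (a + a') (b + b') (c + c') (d + d')"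
  by (simp add: vec_eq_iff forall_2)

lemma diff_mat2 [simp]: "mat2 a b c d - mat2 a' b' c' d' = mat2 (a - a') (b - b') (c - c') (d - d')"
  by (simp add: vec_eq_iff forall_2)

lemma det_mat2 [simp]: "det (mat2 a b c d) = a * d - b * c"
  by (simp add: det_2)

lemma trace_mat2 [simp]: "trace (mat2 a b c d) = a + d"
  by (simp add: trace_def sum_2)

lemma matrix_inv_mat2:
  assumes "a * d - b * c = 1"
  shows "matrix_inv (mat2 a b c d) = mat2 d (-b) (-c) a"
proof -
  have inv: "mat2 a b c d ** mat2 d (-b) (-c) a = mat 1"
    "mat2 d (-b) (-c) a ** mat2 a b c d = mat 1"
    using assms by (simp_all add: mat_eq_mat2 algebra_simps)
  have "mat2 a b c d ** matrix_inv (mat2 a b c d) = mat 1 \<and>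
      matrix_inv (mat2 a b c d) ** mat2 a b c d = mat 1"
    unfolding matrix_inv_def by (rule someI[of _ "mat2 d (-b) (-c) a"]) (intro conjI inv)
  \<comment> \<open>\<open>matrix_inv\<close> is a choice, known so far only to be some two-sided
    inverse; associativity forces it to equal the adjugate.\<close>
  then have "matrix_inv (mat2 a b c d) =
      (matrix_inv (mat2 a b c d) ** mat2 a b c d) ** mat2 d (-b) (-c) a"
    unfolding matrix_mul_assoc[symmetric] inv by simp
  then show ?thesis
    using \<open>_ \<and> _\<close> by simp
qed

section \<open>The ring of integers\<close>

definition Z_theta :: "complex set" where
  "Z_theta = {of_int a + of_int b * theta | a b. True}"

lemma Z_thetaI: "of_int a + of_int b * theta \<in> Z_theta"
  by (auto simp: Z_theta_def)

lemma Z_thetaE: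
  assumes "x \<in> Z_theta"
  obtains a b :: int where "x = of_int a + of_int b * theta"
  using assms by (auto simp: Z_theta_def)

lemma theta_squared: "theta * theta = theta - 2"
proof -
  have "complex_of_real (sqrt 7) * complex_of_real (sqrt 7) = 7"
    by (simp flip: of_real_mult)
  then show ?thesis
    by (simp add: theta_def field_simps)
qed

lemma theta_nonzero [simp]: "theta \<noteq> 0"
  using theta_squared by auto

text \<open>\<open>theta\<close> is not real, so the imaginary part determines the second
  coordinate.\<close>

lemma Z_theta_eq_iff:
  "of_int a + of_int b * theta = of_int c + of_int d * theta \<longleftrightarrow> a = c \<and> b = d"
proof
  assume eq: "of_int a + of_int b * theta = of_int c + of_int d * theta"
  have Im: "Im (of_int k + of_int l * theta) = of_int l * sqrt 7 / 2"
    and Re: "Re (of_int k + of_int l * theta) = of_int k + of_int l / 2" for k l :: int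
    by (simp_all add: theta_def)
  have "b = d"
    using arg_cong[OF eq, of Im] unfolding Im by simp
  with eq show "a = c \<and> b = d"
    by simp
qed auto

lemma Z_theta_mult_eq:
  "(of_int a + of_int b * theta) * (of_int c + of_int d * theta) =
    of_int (a * c - 2 * b * d) + of_int (a * d + b * c + b * d) * theta"
proof -
  have "(of_int a + of_int b * theta) * (of_int c + of_int d * theta) =
    of_int (a * c) + of_int (a * d + b * c) * theta + of_int (b * d) * (theta * theta)"
    by (simp add: algebra_simps)
  then show ?thesis
    by (simp add: theta_squared algebra_simps)
qed

lemma of_int_Z_theta [simp, intro]: "of_int a \<in> Z_theta"
  using Z_thetaI[of a 0] by simp

lemma numeral_Z_theta [simp, intro]:
  "0 \<in> Z_theta" "1 \<in> Z_theta" "numeral n \<in> Z_theta" "theta \<in> Z_theta"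
  using of_int_Z_theta[of 0] of_int_Z_theta[of 1] of_int_Z_theta[of "numeral n"] Z_thetaI[of 0 1]
  by simp_all

lemma Z_theta_add [simp, intro]:
  assumes "x \<in> Z_theta" "y \<in> Z_theta"
  shows "x + y \<in> Z_theta"
proof -
  obtain a b c d :: int where "x = of_int a + of_int b * theta" "y = of_int c + of_int d * theta"
    using assms by (metis Z_thetaE)
  then have "x + y = of_int (a + c) + of_int (b + d) * theta"
    by (simp add: algebra_simps)
  then show ?thesis
    using Z_thetaI by metis
qed

lemma Z_theta_mult [simp, intro]: "x \<in> Z_theta \<Longrightarrow> y \<in> Z_theta \<Longrightarrow> x * y \<in> Z_theta"
  by (metis Z_thetaE Z_thetaI Z_theta_mult_eq)

lemma Z_theta_minus [simp, intro]: "x \<in> Z_theta \<Longrightarrow> - x \<in> Z_theta"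
  using Z_theta_mult[OF of_int_Z_theta[of "-1"]] by simp

lemma Z_theta_diff [simp, intro]: "x \<in> Z_theta \<Longrightarrow> y \<in> Z_theta \<Longrightarrow> x - y \<in> Z_theta"
  using Z_theta_add[OF _ Z_theta_minus, of x y] by simp

lemma Z_theta_power [simp, intro]: "x \<in> Z_theta \<Longrightarrow> x ^ n \<in> Z_theta"
  by (induction n) auto

text \<open>The norm of \<open>a + b * theta\<close>, that is, its product with its complex
  conjugate, as a form in the integer coordinates.\<close>

definition nrm :: "int \<Rightarrow> int \<Rightarrow> int" where
  "nrm a b = a * a + a * b + 2 * b * b"

text \<open>Multiplicativity of the norm; the arguments on the left are the coordinates of the
  product in \<open>Z_theta_mult_eq\<close>.\<close>

lemma nrm_mult:
  "nrm (a * c - 2 * b * d) (a * d + b * c + b * d) = nrm a b * nrm c d"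
  by (simp add: nrm_def algebra_simps)

lemma four_nrm: "4 * nrm a b = (2 * a + b)\<^sup>2 + 7 * b\<^sup>2"
  by (simp add: nrm_def power2_eq_square algebra_simps)

lemma nrm_nonneg: "nrm a b \<ge> 0"
  using four_nrm[of a b] by (smt (verit) zero_le_power2)

lemma nrm_le_4_bounds:
  assumes "nrm a b \<le> 4"
  shows "b \<in> {-1, 0, 1}" "a \<in> {-2, -1, 0, 1, 2}"
proof -
  have le: "(2 * a + b)\<^sup>2 + 7 * b\<^sup>2 \<le> 16"
    using assms four_nrm[of a b] by linarith
  have "b\<^sup>2 < 4"
    using le zero_le_power2[of "2 * a + b"] by linarith
  then have "b\<^sup>2 < 2\<^sup>2"
    by simp
  then have b: "\<bar>b\<bar> < 2"
    by (metis abs_numeral power2_less_imp_less power2_abs abs_ge_zero zero_le_numeral)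
  have "(2 * a + b)\<^sup>2 < 25"
    using le zero_le_power2[of b] by linarith
  then have "(2 * a + b)\<^sup>2 < 5\<^sup>2"
    by simp
  then have "\<bar>2 * a + b\<bar> < 5"
    by (metis power2_less_imp_less power2_abs zero_le_numeral)
  with b show "b \<in> {-1, 0, 1}" "a \<in> {-2, -1, 0, 1, 2}"
    by auto
qed

lemma int_mult_eq_pos_bounds:
  fixes m n k :: int
  assumes "m * n = k" "k > 0" "m \<ge> 0" "n \<ge> 0"
  shows "m \<le> k" "n \<le> k"
  using assms by (auto intro!: zdvd_imp_le)

lemma Z_theta_unit:
  assumes "n \<in> Z_theta" "m \<in> Z_theta" "n * m = 1"
  shows "n = 1 \<or> n = - 1"
proof -
  obtain a b c d :: int
    where n: "n = of_int a + of_int b * theta" and m: "m = of_int c + of_int d * theta"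
    using assms by (metis Z_thetaE)
  have "of_int (a * c - 2 * b * d) + of_int (a * d + b * c + b * d) * theta
      = of_int 1 + of_int 0 * theta"
    using assms(3) unfolding n m Z_theta_mult_eq by simp
  then have eq: "a * c - 2 * b * d = 1" "a * d + b * c + b * d = 0"
    unfolding Z_theta_eq_iff by auto
  have "nrm a b * nrm c d = 1"
    using nrm_mult[of a c b d] unfolding eq by (simp add: nrm_def)
  then have "nrm a b = 1"
    using nrm_nonneg[of a b] by (metis zmult_eq_1_iff linorder_not_less neg_less_0_iff_less zero_less_one)
  then have "(a = 1 \<or> a = -1) \<and> b = 0"
    using nrm_le_4_bounds[of a b] by (auto simp: nrm_def)
  then show ?thesis
    by (auto simp: n)
qed

text \<open>Taking norms, \<open>u\<close> and \<open>w\<close> have norms with product 4, which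
  bounds their coordinates. Up to sign the pair is \<open>theta, theta\<close> or consists of 1 and
  \<open>theta\<^sup>2\<close>; comparing coordinates in \<open>x\<^sup>2 = 4 + u - w\<close> leaves
  only \<open>u = w\<close>.\<close>

lemma square_Z_theta_eq_4:
  assumes "x \<in> Z_theta" "u \<in> Z_theta" "w \<in> Z_theta"
    and uw: "u * w = theta\<^sup>2 \<or> u * w = - theta\<^sup>2"
    and x: "x\<^sup>2 = 4 + u - w"
  shows "x\<^sup>2 = 4"
proof -
  obtain a b c d p q :: int
    where u: "u = of_int a + of_int b * theta" and w: "w = of_int c + of_int d * theta"
      and xe: "x = of_int p + of_int q * theta"
    using assms by (metis Z_thetaE)
  have "of_int (a * c - 2 * b * d) + of_int (a * d + b * c + b * d) * theta
      = of_int (-2) + of_int 1 * theta \<or>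
    of_int (a * c - 2 * b * d) + of_int (a * d + b * c + b * d) * theta
      = of_int 2 + of_int (-1) * theta"
    using uw unfolding u w Z_theta_mult_eq by (auto simp: power2_eq_square theta_squared)
  then have eq: "(a * c - 2 * b * d = -2 \<and> a * d + b * c + b * d = 1) \<or>
      (a * c - 2 * b * d = 2 \<and> a * d + b * c + b * d = -1)"
    unfolding Z_theta_eq_iff by auto
  then have "nrm a b * nrm c d = 4"
    using nrm_mult[of a c b d] by (auto simp: nrm_def)
  then have "nrm a b \<le> 4" "nrm c d \<le> 4"
    using int_mult_eq_pos_bounds nrm_nonneg by (metis zero_less_numeral)+
  note bounds = nrm_le_4_bounds[OF this(1)] nrm_le_4_bounds[OF this(2)]
  have "of_int (p * p - 2 * q * q) + of_int (p * q + q * p + q * q) * theta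
      = of_int (4 + a - c) + of_int (b - d) * theta"
    using x unfolding xe u w power2_eq_square Z_theta_mult_eq by (simp add: algebra_simps)
  then have sq: "p * p - 2 * q * q = 4 + a - c" "q * (2 * p + q) = b - d"
    unfolding Z_theta_eq_iff by (auto simp: algebra_simps)
  \<comment> \<open>Excludes \<open>u = - w\<close> with \<open>u\<close> equal to
    \<open>theta\<close> or its negative. The product is odd or a multiple of 4.\<close>
  have not_2: "q * (2 * p + q) \<noteq> 2" "q * (2 * p + q) \<noteq> - 2"
  proof -
    have "q * (2 * p + q) \<noteq> 2 * k" if "odd k" for k
    proof
      assume *: "q * (2 * p + q) = 2 * k"
      then have "even q"
        by (metis dvd_triv_left even_add even_mult_iff)
      then obtain r where "q = 2 * r" by blast
      with * have "k = 2 * (r * (p + r))"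
        by (simp add: algebra_simps)
      with that show False by simp
    qed
    from this[of 1] this[of "-1"] show "q * (2 * p + q) \<noteq> 2" "q * (2 * p + q) \<noteq> - 2"
      by auto
  qed
  \<comment> \<open>Excludes the case where \<open>u\<close> or \<open>w\<close> is a unit:
    \<open>p * p - 2 * q * q\<close> is then negative, while \<open>4 + a - c\<close> is at least
    1.\<close>
  have unit: "q * q = 1 \<and> p * p \<le> 1" if "q * (2 * p + q) = 1 \<or> q * (2 * p + q) = - 1"
  proof -
    have "q = 1 \<or> q = - 1"
      using that by (metis dvd_triv_left dvd_minus_iff zdvd1_eq abs_eq_iff' abs_1)
    moreover have "p = 0 \<or> p = 1 \<or> p = - 1"
      using calculation that by auto
    ultimately show ?thesis by auto
  qed
  have "a = c \<and> b = d"
    using bounds eq sq(1) not_2[unfolded sq(2)] unit[unfolded sq(2)]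
    by (elim insertE emptyE disjE; simp)
  then show ?thesis
    using x by (simp add: u w)
qed

section \<open>Congruence conditions on the group\<close>

text \<open>Being upper unitriangular modulo \<open>theta\<close> survives products and inverses.
  The determinant is carried along so that inverses are adjugates.\<close>

lemma Gamma_entries:
  assumes "M \<in> Gamma"
  shows "\<exists>a\<in>Z_theta. \<exists>b\<in>Z_theta. \<exists>c\<in>Z_theta. \<exists>d\<in>Z_theta.
    M = mat2 (1 + theta * a) b (theta * c) (1 + theta * d) \<and>
    (1 + theta * a) * (1 + theta * d) - b * (theta * c) = 1"
  using assms unfolding Gamma_def psl_gen_def
proof (induction rule: gen_grp.induct)
  case gen_one
  show ?case
    by (intro bexI[of _ 0]) (auto simp: mat_eq_mat2)
next
  case (gen_base s)
  then consider "s = - mat 1" | "s = matA" | "s = matB" by auto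
  then show ?case
  proof cases
    case 1
    \<comment> \<open>As \<open>theta\<close> divides 2, -1 is congruent to 1, so the lift
      \<open>- mat 1\<close> satisfies the congruence too.\<close>
    have [simp]: "theta * (theta - 1) = -2"
      by (simp add: algebra_simps theta_squared)
    show ?thesis
      by (rule bexI[of _ "theta - 1"], rule bexI[of _ 0], rule bexI[of _ 0],
          rule bexI[of _ "theta - 1"]) (auto simp: 1 mat_eq_mat2)
  next
    case 2
    show ?thesis
      by (rule bexI[of _ 0], rule bexI[of _ 1], rule bexI[of _ 0], rule bexI[of _ 0])
        (auto simp: 2 matA_def)
  next
    case 3
    show ?thesis
      by (rule bexI[of _ 0], rule bexI[of _ 0], rule bexI[of _ 1], rule bexI[of _ 0])
        (auto simp: 3 matB_def)
  qed
next
  case (gen_mult x y)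
  from gen_mult.IH(1) obtain a b c d where
    x: "a \<in> Z_theta" "b \<in> Z_theta" "c \<in> Z_theta" "d \<in> Z_theta"
      "x = mat2 (1 + theta * a) b (theta * c) (1 + theta * d)"
      "(1 + theta * a) * (1 + theta * d) - b * (theta * c) = 1"
    by blast
  from gen_mult.IH(2) obtain a' b' c' d' where
    y: "a' \<in> Z_theta" "b' \<in> Z_theta" "c' \<in> Z_theta" "d' \<in> Z_theta"
      "y = mat2 (1 + theta * a') b' (theta * c') (1 + theta * d')"
      "(1 + theta * a') * (1 + theta * d') - b' * (theta * c') = 1"
    by blast
  let ?a = "a + a' + theta * a * a' + b * c'"
  let ?b = "(1 + theta * a) * b' + b * (1 + theta * d')"
  let ?c = "c * (1 + theta * a') + (1 + theta * d) * c'"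
  let ?d = "d + d' + theta * d * d' + c * b'"
  have "(1 + theta * ?a) * (1 + theta * ?d) - ?b * (theta * ?c) =
    ((1 + theta * a) * (1 + theta * d) - b * (theta * c)) *
    ((1 + theta * a') * (1 + theta * d') - b' * (theta * c'))"
    by (simp add: algebra_simps)
  also have "\<dots> = 1" using x(6) y(6) by simp
  finally have det: "(1 + theta * ?a) * (1 + theta * ?d) - ?b * (theta * ?c) = 1" .
  show ?case
    by (rule bexI[of _ ?a], rule bexI[of _ ?b], rule bexI[of _ ?c], rule bexI[of _ ?d],
        rule conjI[OF _ det]) (use x(1-4) y(1-4) in \<open>auto simp: x(5) y(5) algebra_simps\<close>)
next
  case (gen_inv x)
  then obtain a b c d where
    R: "a \<in> Z_theta" "b \<in> Z_theta" "c \<in> Z_theta" "d \<in> Z_theta" and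
    x: "x = mat2 (1 + theta * a) b (theta * c) (1 + theta * d)" and
    det: "(1 + theta * a) * (1 + theta * d) - b * (theta * c) = 1"
    by blast
  show ?case
    by (rule bexI[of _ d], rule bexI[of _ "-b"], rule bexI[of _ "-c"], rule bexI[of _ a])
      (use R det in \<open>auto simp: x matrix_inv_mat2[OF det] algebra_simps\<close>)
qed

lemma trace_Gamma: "M \<in> Gamma \<Longrightarrow> trace M \<in> Z_theta"
  by (drule Gamma_entries) auto

lemma det_Gamma: "M \<in> Gamma \<Longrightarrow> det M = 1"
  by (drule Gamma_entries) (auto simp: det_2)

lemma Gamma_mult: "M \<in> Gamma \<Longrightarrow> N \<in> Gamma \<Longrightarrow> M ** N \<in> Gamma"
  unfolding Gamma_def psl_gen_def by (rule gen_mult)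

text \<open>The identity drops out of the commutator, and every remaining entry is divisible by
  \<open>theta\<close>, the lower left one even by \<open>theta\<^sup>2\<close>.\<close>

lemma det_commutator_Gamma:
  assumes "M \<in> Gamma" "N \<in> Gamma"
  shows "\<exists>n\<in>Z_theta. det (M ** N - N ** M) = theta\<^sup>2 * n"
proof -
  from Gamma_entries[OF assms(1)] obtain a b c d where
    M: "a \<in> Z_theta" "b \<in> Z_theta" "c \<in> Z_theta" "d \<in> Z_theta"
      "M = mat2 (1 + theta * a) b (theta * c) (1 + theta * d)"
    by blast
  from Gamma_entries[OF assms(2)] obtain a' b' c' d' where
    N: "a' \<in> Z_theta" "b' \<in> Z_theta" "c' \<in> Z_theta" "d' \<in> Z_theta"
      "N = mat2 (1 + theta * a') b' (theta * c') (1 + theta * d')"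
    by blast
  let ?n = "- (b * c' - b' * c)\<^sup>2
    - theta * (b' * (a - d) - b * (a' - d')) * (c * (a' - d') - c' * (a - d))"
  have "?n \<in> Z_theta"
    using M(1-4) N(1-4) by simp
  moreover have "det (M ** N - N ** M) = theta\<^sup>2 * ?n"
    by (simp add: M(5) N(5) det_2 power2_eq_square algebra_simps)
  ultimately show ?thesis by blast
qed

section \<open>The order spanned by a generating pair\<close>

definition order_comb ::
    "cmat2 \<Rightarrow> cmat2 \<Rightarrow> complex \<Rightarrow> complex \<Rightarrow> complex \<Rightarrow> complex \<Rightarrow> cmat2" where
  "order_comb X Y a b c d = mat a + mat b ** X + mat c ** Y + mat d ** (X ** Y)"

text \<open>Cayley-Hamilton: the square of \<open>X\<close> is \<open>trace X\<close> times
  \<open>X\<close> minus the identity.\<close>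

lemma order_comb_mult_left1:
  assumes "det X = 1"
  shows "X ** order_comb X Y a b c d = order_comb X Y (-b) (a + trace X * b) (-d) (c + trace X * d)"
proof -
  obtain x1 x2 x3 x4 where X: "X = mat2 x1 x2 x3 x4" by (rule mat2_cases)
  obtain y1 y2 y3 y4 where Y: "Y = mat2 y1 y2 y3 y4" by (rule mat2_cases)
  have "x1 * x4 - x2 * x3 = 1" using assms X by simp
  then show ?thesis
    unfolding order_comb_def X Y mat_eq_mat2 by simp algebra
qed

text \<open>Polarized Cayley-Hamilton rewrites \<open>Y ** X\<close> in the spanning set, and then
  \<open>Y ** X ** Y\<close> as well.\<close>

lemma order_comb_mult_left2:
  assumes "det X = 1" "det Y = 1"
  shows "Y ** order_comb X Y a b c d = order_comb X Y
    (b * (trace (X ** Y) - trace X * trace Y) - c - d * trace X)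
    (b * trace Y + d)
    (a + b * trace X + c * trace Y + d * trace (X ** Y))
    (- b)"
proof -
  obtain x1 x2 x3 x4 where X: "X = mat2 x1 x2 x3 x4" by (rule mat2_cases)
  obtain y1 y2 y3 y4 where Y: "Y = mat2 y1 y2 y3 y4" by (rule mat2_cases)
  have "x1 * x4 - x2 * x3 = 1" "y1 * y4 - y2 * y3 = 1" using assms X Y by simp_all
  then show ?thesis
    unfolding order_comb_def X Y mat_eq_mat2 by simp algebra
qed

lemma order_comb_add:
  "order_comb X Y a b c d + order_comb X Y a' b' c' d' =
    order_comb X Y (a + a') (b + b') (c + c') (d + d')"
  by (cases X rule: mat2_cases; cases Y rule: mat2_cases)
    (simp add: order_comb_def mat_eq_mat2 algebra_simps)

lemma order_comb_scale:
  "mat k ** order_comb X Y a b c d = order_comb X Y (k * a) (k * b) (k * c) (k * d)"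
  by (cases X rule: mat2_cases; cases Y rule: mat2_cases)
    (simp add: order_comb_def mat_eq_mat2 algebra_simps)

lemma trace_order_comb:
  "trace (order_comb X Y a b c d) = 2 * a + b * trace X + c * trace Y + d * trace (X ** Y)"
  by (cases X rule: mat2_cases; cases Y rule: mat2_cases)
    (simp add: order_comb_def mat_eq_mat2 algebra_simps)

text \<open>
  With \<open>K = XY - YX\<close> the commutator of the two combinations is \<open>p K + q X K + r K Y\<close>, and
  \<open>X K = K adj X\<close> since \<open>K\<close> and \<open>X K\<close> have trace zero; the second factor on the right is
  \<open>det (p + q adj X + r Y)\<close>.
\<close>

lemma det_commutator_order_comb:
  assumes "det X = 1" "det Y = 1"
    and "M = order_comb X Y a b c d" "N = order_comb X Y a' b' c' d'"
    and p: "p = b * c' - b' * c" and q: "q = b * d' - b' * d" and r: "r = d * c' - d' * c"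
  shows "det (M ** N - N ** M) = det (X ** Y - Y ** X) *
    (p\<^sup>2 + q\<^sup>2 + r\<^sup>2 + p * q * trace X + p * r * trace Y + q * r * trace (X ** Y))"
proof -
  obtain x1 x2 x3 x4 where X: "X = mat2 x1 x2 x3 x4" by (rule mat2_cases)
  obtain y1 y2 y3 y4 where Y: "Y = mat2 y1 y2 y3 y4" by (rule mat2_cases)
  have det: "x1 * x4 - x2 * x3 = 1" "y1 * y4 - y2 * y3 = 1" using assms X Y by simp_all
  let ?K = "X ** Y - Y ** X"
  let ?Q = "mat2 (p + q * x4 + r * y1) (r * y2 - q * x2) (r * y3 - q * x3) (p + q * x1 + r * y4)"
  have "M ** N - N ** M = ?K ** ?Q"
    unfolding assms(3,4) p q r order_comb_def X Y mat_eq_mat2 by (simp add: algebra_simps)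
  moreover have "det ?Q = p\<^sup>2 + q\<^sup>2 + r\<^sup>2 + p * q * trace X + p * r * trace Y + q * r * trace (X ** Y)"
    unfolding X Y using det by simp algebra
  ultimately show ?thesis by (simp add: det_mul)
qed

text \<open>The span is stable under left multiplication by \<open>X\<close> and \<open>Y\<close>,
  hence is a ring; inverses stay inside because the traces lie in \<open>Z_theta\<close>.\<close>

lemma gen_pair_in_order:
  assumes X: "det X = 1" "trace X \<in> Z_theta" and Y: "det Y = 1" "trace Y \<in> Z_theta"
    and XY: "trace (X ** Y) \<in> Z_theta" and M: "M \<in> psl_gen {X, Y}"
  shows "\<exists>a\<in>Z_theta. \<exists>b\<in>Z_theta. \<exists>c\<in>Z_theta. \<exists>d\<in>Z_theta. M = order_comb X Y a b c d"
proof -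
  define S where
    "S = {order_comb X Y a b c d | a b c d.
      a \<in> Z_theta \<and> b \<in> Z_theta \<and> c \<in> Z_theta \<and> d \<in> Z_theta}"
  have SI: "order_comb X Y a b c d \<in> S"
    if "a \<in> Z_theta" "b \<in> Z_theta" "c \<in> Z_theta" "d \<in> Z_theta" for a b c d
    using that unfolding S_def by blast
  have SE: thesis
    if "U \<in> S"
      and "\<And>a b c d. \<lbrakk>U = order_comb X Y a b c d; a \<in> Z_theta; b \<in> Z_theta; c \<in> Z_theta;
        d \<in> Z_theta\<rbrakk> \<Longrightarrow> thesis" for U thesis
    using that unfolding S_def by blast
  have S_X: "X ** U \<in> S" if "U \<in> S" for U
    using that X by (auto simp: order_comb_mult_left1 elim!: SE intro!: SI)
  have S_Y: "Y ** U \<in> S" if "U \<in> S" for U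
    using that X Y XY by (auto simp: order_comb_mult_left2 elim!: SE intro!: SI)
  have S_add: "U + V \<in> S" if "U \<in> S" "V \<in> S" for U V
    using that by (auto simp: order_comb_add elim!: SE intro!: SI)
  have S_scale: "mat k ** U \<in> S" if "U \<in> S" "k \<in> Z_theta" for U k
    using that by (auto simp: order_comb_scale elim!: SE intro!: SI)
  have S_mult: "U ** V \<in> S" if U: "U \<in> S" and V: "V \<in> S" for U V
  proof -
    obtain a b c d where R: "a \<in> Z_theta" "b \<in> Z_theta" "c \<in> Z_theta" "d \<in> Z_theta"
      and U: "U = order_comb X Y a b c d"
      using U unfolding S_def by blast
    have "U ** V = mat a ** V + mat b ** (X ** V) + mat c ** (Y ** V) + mat d ** (X ** (Y ** V))"
      unfolding U
      by (cases X rule: mat2_cases; cases Y rule: mat2_cases; cases V rule: mat2_cases)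
        (simp add: order_comb_def mat_eq_mat2 algebra_simps)
    then show ?thesis
      using R V by (auto intro!: S_add S_scale S_X S_Y)
  qed
  have S_const: "mat k \<in> S" if "k \<in> Z_theta" for k
  proof -
    have "mat k = order_comb X Y k 0 0 0"
      by (cases X rule: mat2_cases; cases Y rule: mat2_cases)
        (simp add: order_comb_def mat_eq_mat2)
    then show ?thesis using SI that by auto
  qed
  have "M \<in> S \<and> det M = 1"
    using M unfolding psl_gen_def
  proof (induction rule: gen_grp.induct)
    case gen_one
    then show ?case using S_const by auto
  next
    case (gen_base s)
    have "X \<in> S" "Y \<in> S"
      using S_X[OF S_const[of 1]] S_Y[OF S_const[of 1]] by auto
    moreover have "- mat 1 \<in> S"
      using S_const[of "-1"] by (simp add: mat_eq_mat2 Z_theta_minus)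
    ultimately show ?case
      using gen_base X Y by (auto simp: mat_eq_mat2)
  next
    case (gen_mult x y)
    then show ?case using S_mult by (auto simp: det_mul)
  next
    case (gen_inv x)
    obtain x1 x2 x3 x4 where x: "x = mat2 x1 x2 x3 x4" by (rule mat2_cases)
    have det: "x1 * x4 - x2 * x3 = 1" using gen_inv x by simp
    have "trace x \<in> Z_theta"
      using gen_inv X Y XY unfolding S_def by (auto simp: trace_order_comb)
    \<comment> \<open>Cayley-Hamilton at determinant 1, which is why the induction also tracks
      \<open>det\<close>.\<close>
    moreover have "matrix_inv x = mat (trace x) + mat (-1) ** x"
      using det by (simp add: x matrix_inv_mat2 mat_eq_mat2)
    ultimately have "matrix_inv x \<in> S"
      using gen_inv by (auto intro!: S_add S_scale S_const)
    moreover have "det (matrix_inv x) = 1"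
      using det by (simp add: x matrix_inv_mat2 algebra_simps)
    ultimately show ?case by blast
  qed
  then show ?thesis unfolding S_def by blast
qed

section \<open>Commutator determinants of generating pairs\<close>

lemma det_commutator_matA_matB: "det (matA ** matB - matB ** matA) = - theta\<^sup>2"
  by (simp add: matA_def matB_def power2_eq_square)

text \<open>Fricke's trace identity: the determinant is 2 minus the trace of the group
  commutator.\<close>

lemma det_commutator_trace:
  fixes X Y :: cmat2
  assumes "det X = 1" "det Y = 1"
  shows "det (X ** Y - Y ** X) =
    4 - (trace X)\<^sup>2 - (trace Y)\<^sup>2 - (trace (X ** Y))\<^sup>2 + trace X * trace Y * trace (X ** Y)"
proof -
  obtain x1 x2 x3 x4 where X: "X = mat2 x1 x2 x3 x4" by (rule mat2_cases)
  obtain y1 y2 y3 y4 where Y: "Y = mat2 y1 y2 y3 y4" by (rule mat2_cases)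
  have "x1 * x4 - x2 * x3 = 1" "y1 * y4 - y2 * y3 = 1" using assms X Y by simp_all
  then show ?thesis
    unfolding X Y by simp algebra
qed

lemma det_commutator_generators:
  assumes "X \<in> Gamma" "Y \<in> Gamma" "psl_gen {X, Y} = Gamma"
  shows "det (X ** Y - Y ** X) = theta\<^sup>2 \<or> det (X ** Y - Y ** X) = - theta\<^sup>2"
proof -
  have AB: "matA \<in> psl_gen {X, Y}" "matB \<in> psl_gen {X, Y}"
    unfolding assms(3) by (auto simp: Gamma_def psl_gen_def intro: gen_base)
  have det: "det X = 1" "det Y = 1" and
    tr: "trace X \<in> Z_theta" "trace Y \<in> Z_theta" "trace (X ** Y) \<in> Z_theta"
    using assms by (auto intro: det_Gamma trace_Gamma Gamma_mult)
  note in_order = gen_pair_in_order[OF det(1) tr(1) det(2) tr(2,3)]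
  obtain a b c d where
    A: "a \<in> Z_theta" "b \<in> Z_theta" "c \<in> Z_theta" "d \<in> Z_theta" "matA = order_comb X Y a b c d"
    using in_order[OF AB(1)] by (elim bexE)
  obtain a' b' c' d' where
    B: "a' \<in> Z_theta" "b' \<in> Z_theta" "c' \<in> Z_theta" "d' \<in> Z_theta"
      "matB = order_comb X Y a' b' c' d'"
    using in_order[OF AB(2)] by (elim bexE)
  define p q r where pqr: "p = b * c' - b' * c" "q = b * d' - b' * d" "r = d * c' - d' * c"
  define m where
    "m = p\<^sup>2 + q\<^sup>2 + r\<^sup>2 + p * q * trace X + p * r * trace Y + q * r * trace (X ** Y)"
  have "p \<in> Z_theta" "q \<in> Z_theta" "r \<in> Z_theta"
    using A B unfolding pqr by auto
  then have m: "m \<in> Z_theta"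
    using tr unfolding m_def by auto
  obtain n where n: "n \<in> Z_theta" "det (X ** Y - Y ** X) = theta\<^sup>2 * n"
    using det_commutator_Gamma assms by blast
  \<comment> \<open>The two divisibilities meet here; cancelling \<open>theta\<^sup>2\<close> makes
    \<open>n\<close> a unit.\<close>
  have "- theta\<^sup>2 = theta\<^sup>2 * n * m"
    using det_commutator_order_comb[OF det A(5) B(5) pqr] n(2) det_commutator_matA_matB
    unfolding m_def by simp
  then have "theta\<^sup>2 * (n * (- m)) = theta\<^sup>2 * 1"
    by (metis minus_minus mult.assoc mult.right_neutral mult_minus_right)
  then have "n * (- m) = 1"
    by (subst (asm) mult_cancel_left) simp
  then have "n = 1 \<or> n = - 1"
    using Z_theta_unit n(1) m by blast
  then show ?thesis
    using n(2) by auto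
qed

theorem theorem1p3:
  fixes X Y :: cmat2
  assumes "X \<in> Gamma" and "Y \<in> Gamma"
    and "psl_gen {X, Y} = Gamma"
    and "trace X = trace Y"
  shows "parabolic X \<and> parabolic Y"
proof -
  have det: "det X = 1" "det Y = 1" and
    tr: "trace X \<in> Z_theta" "trace (X ** Y) \<in> Z_theta"
    using assms by (auto intro: det_Gamma trace_Gamma Gamma_mult)
  have K: "det (X ** Y - Y ** X) = theta\<^sup>2 \<or> det (X ** Y - Y ** X) = - theta\<^sup>2"
    using det_commutator_generators assms(1-3) .
  \<comment> \<open>With equal traces the Fricke polynomial factors; these factors satisfy
    \<open>4 + ?u - ?w = (trace X)\<^sup>2\<close>.\<close>
  let ?u = "trace (X ** Y) - 2" and ?w = "trace (X ** Y) + 2 - (trace X)\<^sup>2"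
  have "det (X ** Y - Y ** X) = - (?u * ?w)"
    using det_commutator_trace[OF det] assms(4) by (simp add: power2_eq_square algebra_simps)
  then have "?u * ?w = theta\<^sup>2 \<or> ?u * ?w = - theta\<^sup>2"
    using K by (metis minus_minus)
  then have "(trace X)\<^sup>2 = 4"
    using tr by (intro square_Z_theta_eq_4[of _ ?u ?w]) auto
  \<comment> \<open>Trace condition aside, parabolicity needs \<open>X\<close> and \<open>Y\<close>
    different from plus or minus the identity, which would commute with everything.\<close>
  moreover have "X ** Y \<noteq> Y ** X"
    using K by (auto simp: det_2)
  then have "X \<noteq> mat 1 \<and> X \<noteq> - mat 1 \<and> Y \<noteq> mat 1 \<and> Y \<noteq> - mat 1"
    by (cases X rule: mat2_cases; cases Y rule: mat2_cases) (auto simp: mat_eq_mat2)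
  ultimately show ?thesis
    using assms(4) by (simp add: parabolic_def)
qed

end
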